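(* Let $X=X_1\ldots X_n$ and $Y=Y_1\ldots Y_n$ be two independent i.i.d. random strings over $\{a,b\}$ with the same letter distribution, and let $p=P(X_1=a)\in(0,1)$. Let $S$ be the scoring function with $S(a,a)=1$, $S(b,b)=-1$, and $S(u,v)=0$ for all other pairs $(u,v)\in\{a,b,G\}^2$. Let $N_a^X$ and $N_a^Y$ be the numbers of letters $a$ in $X$ and in $Y$ respectively. Then $$L_n(S)=\min\{N_a^X,N_a^Y\},$$ and, as $n\to\infty$, $$\frac{L_n(S)-E[N_a^X]}{\sqrt{np(1-p)}}$$ converges in law to $\min\{\mathcal N_1,\mathcal N_2\}$, where $\mathcal N_1,\mathcal N_2$ are two independent standard normal random variables; in particular the limiting distribution is not normal.
   Context: $G$ denotes the gap symbol. An alignment with gaps $\pi$ of strings $x_1\ldots x_n$ and $y_1\ldots y_n$ consists of an integer $0\le i\le n$ and increasing integer sequences $1\le\nu_1<\cdots<\nu_i\le n$ and $1\le\mu_1<\cdots<\mu_i\le n$: the letter $x_{\nu_j}$ is aligned with $y_{\mu_j}$ for $j=1,\ldots,i$, and every remaining letter of either string is aligned with a gap (gaps are never aligned with gaps). The alignment score $S_\pi(x,y)$ is the sum of $S$ over all aligned pairs of symbols, including the pairs (letter, gap). $L_n(S)=\max_\pi S_\pi(X,Y)$ is the optimal alignment score. *)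

theory Defs
  imports "HOL-Probability.Probability"
begin

(* Strings are functions on the positions 1, ..., n. Symbols are letters extended by the gap
   symbol G, which is None. *)

type_synonym 'l symbol = "'l option"

abbreviation (input) G :: "'l symbol" where
  "G \<equiv> None"

(* A pair (nu, mu) of lists of positions; the number i of aligned letter pairs is their
   common length. *)
definition alignments :: "nat \<Rightarrow> (nat list \<times> nat list) set" where
  "alignments n = {(\<nu>, \<mu>). length \<nu> = length \<mu> \<and>
     sorted_wrt (<) \<nu> \<and> set \<nu> \<subseteq> {1..n} \<and>
     sorted_wrt (<) \<mu> \<and> set \<mu> \<subseteq> {1..n}}"

definition alignment_score ::
  "('l symbol \<Rightarrow> 'l symbol \<Rightarrow> real) \<Rightarrow> nat \<Rightarrow> (nat \<Rightarrow> 'l) \<Rightarrow> (nat \<Rightarrow> 'l) \<Rightarrow>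
   nat list \<times> nat list \<Rightarrow> real" where
  "alignment_score S n x y = (\<lambda>(\<nu>, \<mu>).
     (\<Sum>j<length \<nu>. S (Some (x (\<nu> ! j))) (Some (y (\<mu> ! j)))) +
     (\<Sum>k\<in>{1..n} - set \<nu>. S (Some (x k)) G) +
     (\<Sum>k\<in>{1..n} - set \<mu>. S G (Some (y k))))"

definition optimal_score ::
  "('l symbol \<Rightarrow> 'l symbol \<Rightarrow> real) \<Rightarrow> nat \<Rightarrow> (nat \<Rightarrow> 'l) \<Rightarrow> (nat \<Rightarrow> 'l) \<Rightarrow> real" where
  "optimal_score S n x y = (MAX \<pi>\<in>alignments n. alignment_score S n x y \<pi>)"

(* The maximum ranges over a finite nonempty set. *)
lemma finite_alignments: "finite (alignments n)"
proof (rule finite_subset)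
  let ?L = "{xs. set xs \<subseteq> {1..n} \<and> distinct xs}"
  show "alignments n \<subseteq> ?L \<times> ?L"
    by (auto simp: alignments_def strict_sorted_iff)
  have "?L \<subseteq> {xs. set xs \<subseteq> {1..n} \<and> length xs \<le> n}"
  proof safe
    fix xs :: "nat list" assume "set xs \<subseteq> {1..n}" "distinct xs"
    then have "length xs \<le> card {1..n}"
      by (metis card_mono distinct_card finite_atLeastAtMost)
    then show "length xs \<le> n" by simp
  qed
  then have "finite ?L"
    by (rule finite_subset) (rule finite_lists_length_le, simp)
  then show "finite (?L \<times> ?L)" by simp
qed

lemma alignments_nonempty: "alignments n \<noteq> {}"
proof -
  have "([], []) \<in> alignments n" by (simp add: alignments_def)
  then show ?thesis by blast
qed

datatype letter = letter_a | letter_b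

fun score :: "letter symbol \<Rightarrow> letter symbol \<Rightarrow> real" where
  "score (Some letter_a) (Some letter_a) = 1"
| "score (Some letter_b) (Some letter_b) = -1"
| "score _ _ = 0"

definition count_a :: "nat \<Rightarrow> (nat \<Rightarrow> letter) \<Rightarrow> nat" where
  "count_a n x = card {i\<in>{1..n}. x i = letter_a}"

end

theory Submission
  imports Defs
begin

text \<open>
  Gaps cost nothing, so only aligned letter pairs contribute, and only pairs (a, a) contribute
  positively. An alignment uses each position at most once, so it contains at most
  \<open>min N\<^sub>a\<^sup>X N\<^sub>a\<^sup>Y\<close> such pairs. Aligning the \<open>j\<close>-th letter a of one string with the \<open>j\<close>-th letter a
  of the other, and everything else with gaps, attains this bound (\<open>optimal_score_score\<close>).

  Subtracting the common mean and dividing by the common scale commutes with the minimum, so the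
  normalized score is the minimum of two independent normalized binomial counts, each of which
  converges to a standard normal law by the central limit theorem (\<open>count_a_weak_conv\<close>). For
  independent \<open>U\<close> and \<open>V\<close> the tail of \<open>min U V\<close> is the product of the two tails
  (\<open>cdf_min_indep\<close>), so pointwise convergence of the distribution functions carries over to the
  minima (\<open>weak_conv_min_indep\<close>).

  If the minimum of two independent standard normal variables had a normal law with density \<open>g\<close>,
  then differentiating \<open>1 - (1 - \<Phi>)\<^sup>2\<close> would give \<open>2 (1 - \<Phi>) \<phi> = g\<close>. Hence \<open>2 (1 - \<Phi>) = g / \<phi>\<close>
  is the exponential of a quadratic polynomial. It has a positive finite limit at minus infinity,
  namely 2, so the polynomial is constant; but \<open>1 - \<Phi>\<close> tends to 0 at plus infinity
  (\<open>cdf_normal_ne_cdf_min_std_normal\<close>).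
\<close>

section \<open>The optimal score counts the scarcer letters a\<close>

lemma score_gap [simp]:
  fixes s :: "letter symbol"
  shows "score s G = 0" "score G s = 0"
  using score.elims by force+

lemma score_le_of_bool:
  "score (Some u) (Some v) \<le> of_bool (u = letter_a \<and> v = letter_a)"
  by (cases u; cases v) auto

text \<open>
  With \<open>f\<close> one of the two position sequences of an alignment, this is where the fact that every
  position is used at most once bounds the number of pairs (a, a).
\<close>

lemma sum_le_card_inj:
  fixes f :: "nat \<Rightarrow> nat"
  assumes "inj_on f {..<k}" "\<And>j. j < k \<Longrightarrow> Q j \<Longrightarrow> f j \<in> A" "finite A"
  shows "(\<Sum>j<k. of_bool (Q j) :: real) \<le> card A"
proof -
  have "(\<Sum>j<k. of_bool (Q j) :: real) = card {j\<in>{..<k}. Q j}"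
    by (simp add: Int_def)
  also have "card {j\<in>{..<k}. Q j} \<le> card A"
    using assms by (intro card_inj_on_le[of f]) (auto intro: inj_on_subset)
  finally show ?thesis by simp
qed

lemma alignment_score_le:
  assumes "\<pi> \<in> alignments n"
  shows "alignment_score score n x y \<pi> \<le> min (real (count_a n x)) (real (count_a n y))"
proof -
  obtain \<nu> \<mu> where \<pi>: "\<pi> = (\<nu>, \<mu>)" by fastforce
  have len: "length \<nu> = length \<mu>"
    and sub: "set \<nu> \<subseteq> {1..n}" "set \<mu> \<subseteq> {1..n}"
    and dist: "distinct \<nu>" "distinct \<mu>"
    using assms by (auto simp: \<pi> alignments_def strict_sorted_iff)
  let ?aa = "\<lambda>j. x (\<nu> ! j) = letter_a \<and> y (\<mu> ! j) = letter_a"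
  have "alignment_score score n x y \<pi> =
      (\<Sum>j<length \<nu>. score (Some (x (\<nu> ! j))) (Some (y (\<mu> ! j))))"
    by (simp add: alignment_score_def \<pi>)
  also have "\<dots> \<le> (\<Sum>j<length \<nu>. of_bool (?aa j))"
    by (intro sum_mono score_le_of_bool)
  finally have le: "alignment_score score n x y \<pi> \<le> (\<Sum>j<length \<nu>. of_bool (?aa j))" .
  have "(\<Sum>j<length \<nu>. of_bool (?aa j) :: real) \<le> count_a n x"
    unfolding count_a_def using sub dist
    by (intro sum_le_card_inj[of "(!) \<nu>"]) (auto intro!: inj_on_nth dest: nth_mem)
  moreover have "(\<Sum>j<length \<nu>. of_bool (?aa j) :: real) \<le> count_a n y"
    unfolding count_a_def using sub dist len
    by (intro sum_le_card_inj[of "(!) \<mu>"]) (auto intro!: inj_on_nth dest: nth_mem)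
  ultimately show ?thesis using le by simp
qed

text \<open>
  The witness takes the first \<open>k\<close> positions of the letter a in each string, where \<open>k\<close> is the smaller
  of the two counts; every other letter, b included, goes to a gap at no cost.
\<close>

lemma alignment_score_attained:
  "\<exists>\<pi>\<in>alignments n. alignment_score score n x y \<pi> = min (real (count_a n x)) (real (count_a n y))"
proof -
  define A where "A z = {i\<in>{1..n}. z i = letter_a}" for z
  define k where "k = min (count_a n x) (count_a n y)"
  define first where "first z = take k (sorted_list_of_set (A z))" for z
  have fin: "finite (A z)" for z by (simp add: A_def)
  have k: "k \<le> card (A x)" "k \<le> card (A y)" by (simp_all add: k_def count_a_def A_def)
  have len: "length (first x) = k" "length (first y) = k"
    using k by (simp_all add: first_def)
  have set: "set (first z) \<subseteq> A z" for z
    unfolding first_def using set_take_subset[of k "sorted_list_of_set (A z)"] fin[of z] by simp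
  have sorted: "sorted_wrt (<) (first z)" for z
    unfolding first_def by (intro sorted_wrt_take strict_sorted_list_of_set)
  have al: "(first x, first y) \<in> alignments n"
    using len sorted set[of x] set[of y] by (auto simp: alignments_def A_def)
  have "x (first x ! j) = letter_a" "y (first y ! j) = letter_a" if "j < k" for j
    using that len nth_mem[of j "first x"] nth_mem[of j "first y"] set[THEN subsetD]
    by (auto simp: A_def)
  then have "alignment_score score n x y (first x, first y) = k"
    by (simp add: alignment_score_def len)
  with al show ?thesis by (auto simp: k_def intro!: bexI[of _ "(first x, first y)"])
qed

lemma optimal_score_score:
  "optimal_score score n x y = min (real (count_a n x)) (real (count_a n y))"
  unfolding optimal_score_def
proof (rule Max_eqI)
  show "min (real (count_a n x)) (real (count_a n y)) \<in> alignment_score score n x y ` alignments n"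
    using alignment_score_attained[of n x y] by (metis imageI)
  show "finite (alignment_score score n x y ` alignments n)"
    using finite_alignments by (rule finite_imageI)
  show "s \<le> min (real (count_a n x)) (real (count_a n y))"
    if "s \<in> alignment_score score n x y ` alignments n" for s
    using that by (elim imageE) (simp only: alignment_score_le)
qed

section \<open>The number of letters a is asymptotically normal\<close>

lemma count_a_eq_sum: "real (count_a n x) = (\<Sum>i<n. of_bool (x (Suc i) = letter_a))"
proof -
  have "{i\<in>{1..n}. x i = letter_a} = Suc ` {i\<in>{..<n}. x (Suc i) = letter_a}"
    by (auto simp: image_iff Bex_def) (metis Suc_le_eq Suc_pred less_eq_Suc_le)
  then have "count_a n x = card {i\<in>{..<n}. x (Suc i) = letter_a}"
    by (simp add: count_a_def card_image)
  then show ?thesis by (simp add: Int_def)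
qed

text \<open>
  The count is a sum of independent indicators, each of variance \<open>p (1 - p)\<close>.
\<close>

lemma (in prob_space)
  fixes Z :: "nat \<Rightarrow> 'a \<Rightarrow> letter"
  assumes indep: "indep_vars (\<lambda>_. count_space UNIV) Z {1..}"
    and ident: "\<And>i. i \<ge> 1 \<Longrightarrow> distr M (count_space UNIV) (Z i) = D"
    and p: "p = measure D {letter_a}" "0 < p" "p < 1"
  shows expectation_count_a: "expectation (\<lambda>\<omega>. real (count_a n (\<lambda>i. Z i \<omega>))) = real n * p"
    and count_a_weak_conv:
      "weak_conv_m (\<lambda>n. distr M borel (\<lambda>\<omega>.
         (real (count_a n (\<lambda>i. Z i \<omega>)) - real n * p) / sqrt (real n * p * (1 - p))))
       std_normal_distribution"
proof -
  have Z [measurable]: "Z (Suc i) \<in> measurable M (count_space UNIV)" for i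
    using indep unfolding indep_vars_def2 by auto
  define c :: "letter \<Rightarrow> real" where "c u = of_bool (u = letter_a)" for u
  have [measurable]: "c \<in> borel_measurable (count_space UNIV)" by simp
  define W where "W i \<omega> = c (Z (Suc i) \<omega>) - p" for i \<omega>
  have W [measurable]: "W i \<in> borel_measurable M" for i
    unfolding W_def by measurable
  have int: "integrable M (\<lambda>\<omega>. c (Z (Suc i) \<omega>))" for i
    by (rule integrable_const_bound[of _ 1]) (auto simp: c_def)
  have Ec: "expectation (\<lambda>\<omega>. c (Z (Suc i) \<omega>)) = p" for i
  proof -
    have "(\<lambda>\<omega>. c (Z (Suc i) \<omega>)) = indicator (Z (Suc i) -` {letter_a})"
      by (auto simp: c_def fun_eq_iff indicator_def)
    then have "expectation (\<lambda>\<omega>. c (Z (Suc i) \<omega>)) = prob (Z (Suc i) -` {letter_a} \<inter> space M)"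
      by simp
    also have "\<dots> = p"
      using ident[of "Suc i"] by (simp add: p(1) measure_distr flip: ident[of "Suc i"])
    finally show ?thesis .
  qed
  show "expectation (\<lambda>\<omega>. real (count_a n (\<lambda>i. Z i \<omega>))) = real n * p"
    using Ec int unfolding count_a_eq_sum c_def[symmetric] by simp

  have EW: "expectation (W i) = 0" for i
    unfolding W_def using Ec int by (simp add: prob_space)
  have W2: "(W i \<omega>)\<^sup>2 = (1 - 2 * p) * c (Z (Suc i) \<omega>) + p\<^sup>2" for i \<omega>
    by (simp add: W_def c_def power2_eq_square algebra_simps)
  have VW: "variance (W i) = (sqrt (p * (1 - p)))\<^sup>2" for i
    using Ec int p(2,3) by (simp add: EW W2 prob_space) (simp add: algebra_simps power2_eq_square)
  \<comment> \<open>Grouping the variables into singleton blocks shifts the index set to start at 0.\<close>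
  have "indep_vars (\<lambda>j. PiM {Suc j} (\<lambda>_. count_space UNIV))
      (\<lambda>j \<omega>. restrict (\<lambda>i. Z i \<omega>) {Suc j}) UNIV"
    by (rule indep_vars_restrict[OF indep]) (auto simp: disjoint_family_on_def)
  then have "indep_vars (\<lambda>_. borel) (\<lambda>j \<omega>. c (restrict (\<lambda>i. Z i \<omega>) {Suc j} (Suc j)) - p) UNIV"
    by (rule indep_vars_compose2) measurable
  then have indW: "indep_vars (\<lambda>_. borel) W UNIV"
    by (simp add: W_def[abs_def])
  have "distr M borel (W i) = distr (distr M (count_space UNIV) (Z (Suc i))) borel (\<lambda>u. c u - p)" for i
    by (simp add: distr_distr o_def W_def[abs_def])
  then have distW: "distr M borel (W i) = distr D borel (\<lambda>u. c u - p)" for i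
    by (simp add: ident)
  have "weak_conv_m (\<lambda>n. distr M borel (\<lambda>\<omega>. (\<Sum>i<n. W i \<omega>) / sqrt (n * (sqrt (p * (1 - p)))\<^sup>2)))
      std_normal_distribution"
  proof (rule central_limit_theorem_zero_mean[OF indW EW _ _ VW distW])
    show "sqrt (p * (1 - p)) > 0" using p(2,3) by simp
    show "integrable M (\<lambda>\<omega>. (W i \<omega>)\<^sup>2)" for i using int by (simp add: W2)
  qed
  moreover have "(\<Sum>i<n. W i \<omega>) / sqrt (n * (sqrt (p * (1 - p)))\<^sup>2) =
      (real (count_a n (\<lambda>i. Z i \<omega>)) - real n * p) / sqrt (real n * p * (1 - p))" for n \<omega>
    using p(2,3) by (simp add: W_def c_def sum_subtractf count_a_eq_sum mult.assoc)
  ultimately show "weak_conv_m (\<lambda>n. distr M borel (\<lambda>\<omega>.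
         (real (count_a n (\<lambda>i. Z i \<omega>)) - real n * p) / sqrt (real n * p * (1 - p))))
       std_normal_distribution" by simp
qed

section \<open>Minima of independent random variables\<close>

text \<open>
  A minimum exceeds \<open>x\<close> exactly if both variables do, so independence makes the tails multiply.
\<close>

lemma (in prob_space) cdf_min_indep:
  fixes U V :: "'a \<Rightarrow> real"
  assumes indep: "indep_var borel U borel V"
  shows "cdf (distr M borel (\<lambda>\<omega>. min (U \<omega>) (V \<omega>))) x =
    1 - (1 - cdf (distr M borel U) x) * (1 - cdf (distr M borel V) x)"
proof -
  have [measurable]: "U \<in> borel_measurable M" "V \<in> borel_measurable M"
    using indep_var_rv1[OF indep] indep_var_rv2[OF indep] by simp_all
  have tail: "1 - cdf (distr M borel W) x = prob (W -` {x<..} \<inter> space M)"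
    if [measurable]: "W \<in> borel_measurable M" for W :: "'a \<Rightarrow> real"
  proof -
    have "prob (space M - W -` {..x} \<inter> space M) = 1 - prob (W -` {..x} \<inter> space M)"
      by (rule prob_compl) measurable
    moreover have "space M - W -` {..x} \<inter> space M = W -` {x<..} \<inter> space M" by auto
    ultimately show ?thesis by (simp add: cdf_def2 measure_distr)
  qed
  have "(\<lambda>\<omega>. min (U \<omega>) (V \<omega>)) -` {x<..} \<inter> space M = 
      (\<lambda>\<omega>. (U \<omega>, V \<omega>)) -` ({x<..} \<times> {x<..}) \<inter> space M" by auto
  then have "prob ((\<lambda>\<omega>. min (U \<omega>) (V \<omega>)) -` {x<..} \<inter> space M) = 
      prob (U -` {x<..} \<inter> space M) * prob (V -` {x<..} \<inter> space M)"
    using indep_varD[OF indep, of "{x<..}" "{x<..}"] by simp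
  then have "1 - cdf (distr M borel (\<lambda>\<omega>. min (U \<omega>) (V \<omega>))) x =
      (1 - cdf (distr M borel U) x) * (1 - cdf (distr M borel V) x)"
    using tail[of "\<lambda>\<omega>. min (U \<omega>) (V \<omega>)"] tail[of U] tail[of V] by simp
  then show ?thesis by simp
qed

text \<open>
  Continuity of both limiting distribution functions is what makes the marginals converge at every
  point. If a marginal had atoms, the distribution function of the minimum could still be continuous
  where that marginal jumps (after the other one has reached 1).
\<close>

lemma weak_conv_min_indep:
  fixes U V :: "nat \<Rightarrow> 'a \<Rightarrow> real" and U' V' :: "'b \<Rightarrow> real"
  assumes "prob_space M" "prob_space P"
    and ind: "\<And>n. prob_space.indep_var M borel (U n) borel (V n)"
    and ind': "prob_space.indep_var P borel U' borel V'"
    and U: "weak_conv_m (\<lambda>n. distr M borel (U n)) (distr P borel U')"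
    and V: "weak_conv_m (\<lambda>n. distr M borel (V n)) (distr P borel V')"
    and cont: "\<And>x. isCont (cdf (distr P borel U')) x" "\<And>x. isCont (cdf (distr P borel V')) x"
  shows "weak_conv_m (\<lambda>n. distr M borel (\<lambda>\<omega>. min (U n \<omega>) (V n \<omega>)))
    (distr P borel (\<lambda>\<omega>. min (U' \<omega>) (V' \<omega>)))"
proof -
  have "(\<lambda>n. cdf (distr M borel (U n)) x) \<longlonglongrightarrow> cdf (distr P borel U') x"
    "(\<lambda>n. cdf (distr M borel (V n)) x) \<longlonglongrightarrow> cdf (distr P borel V') x" for x
    using U V cont by (simp_all add: weak_conv_m_def weak_conv_def)
  then show ?thesis
    unfolding weak_conv_m_def weak_conv_def
      prob_space.cdf_min_indep[OF \<open>prob_space M\<close> ind]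
      prob_space.cdf_min_indep[OF \<open>prob_space P\<close> ind']
    by (intro allI impI tendsto_intros)
qed

section \<open>The minimum of two standard normal variables is not normal\<close>

lemma cdf_density_has_derivative:
  fixes f :: "real \<Rightarrow> real"
  assumes prob: "prob_space (density lborel f)"
    and cont: "continuous_on UNIV f" and nonneg: "\<And>x. 0 \<le> f x"
  shows "(cdf (density lborel f) has_real_derivative f x) (at x)"
proof -
  interpret D: real_distribution "density lborel f"
    using prob by (simp add: real_distribution_def real_distribution_axioms_def)
  have [measurable]: "f \<in> borel_measurable borel"
    using cont by (rule borel_measurable_continuous_onI)
  \<comment> \<open>The base point \<open>x - 1\<close> keeps \<open>x\<close> in the interior of a compact interval, on which the
    fundamental theorem of calculus applies.\<close>
  have diff: "cdf (density lborel f) y = cdf (density lborel f) (x - 1) + integral {x-1..y} f"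
    if "y \<in> {x-1..x+1}" for y
  proof (cases "y = x - 1")
    case False
    with that have y: "x - 1 < y" by simp
    have int: "set_integrable lborel {x-1..y} f"
      using cont by (intro borel_integrable_atLeastAtMost') (auto intro: continuous_on_subset)
    have "emeasure (density lborel f) {x-1<..y} = (\<integral>\<^sup>+z. f z * indicator {x-1<..y} z \<partial>lborel)"
      by (subst emeasure_density) (auto simp: ennreal_mult' nonneg intro!: nn_integral_cong split: split_indicator)
    also have "\<dots> = (\<integral>\<^sup>+z. f z * indicator {x-1..y} z \<partial>lborel)"
      using AE_lborel_singleton[of "x - 1"]
      by (intro nn_integral_cong_AE) (auto split: split_indicator)
    also have "\<dots> = ennreal (LINT z:{x-1..y}|lborel. f z)"
      using int nonneg unfolding set_lebesgue_integral_def set_integrable_def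
      by (subst nn_integral_eq_integral[symmetric])
         (auto simp: ennreal_mult' mult.commute intro!: nn_integral_cong split: split_indicator)
    also have "(LINT z:{x-1..y}|lborel. f z) = integral {x-1..y} f"
      by (rule set_borel_integral_eq_integral[OF int])
    finally have "measure (density lborel f) {x-1<..y} = integral {x-1..y} f"
      using nonneg by (simp add: measure_def integral_nonneg set_borel_integral_eq_integral(1)[OF int])
    then show ?thesis using D.cdf_diff_eq[OF y] by simp
  qed simp
  have "((\<lambda>y. integral {x-1..y} f) has_real_derivative f x) (at x within {x-1..x+1})"
    by (rule integral_has_real_derivative) (auto intro: continuous_on_subset[OF cont])
  then have "((\<lambda>y. cdf (density lborel f) (x - 1) + integral {x-1..y} f) has_real_derivative f x)
      (at x within {x-1..x+1})"
    by (auto intro!: derivative_eq_intros)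
  then have "(cdf (density lborel f) has_real_derivative f x) (at x within {x-1..x+1})"
    by (rule has_field_derivative_transform_within[OF _ zero_less_one])
      (simp, rule diff[symmetric])
  then show ?thesis by (simp add: at_within_Icc_at)
qed

lemma cdf_normal_has_derivative:
  assumes "\<sigma> > 0"
  shows "(cdf (density lborel (normal_density m \<sigma>)) has_real_derivative normal_density m \<sigma> x) (at x)"
proof (rule cdf_density_has_derivative)
  show "continuous_on UNIV (normal_density m \<sigma>)"
    unfolding normal_density_def[abs_def] using assms by (intro continuous_intros) simp_all
qed (use assms in \<open>simp_all add: prob_space_normal_density\<close>)

lemma isCont_cdf_std_normal: "isCont (cdf std_normal_distribution) x"
  by (rule DERIV_isCont[OF cdf_normal_has_derivative]) simp

text \<open>
  The second difference of the sequence is the constant \<open>2 A\<close> and, once \<open>A = 0\<close>, the first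
  difference is the constant \<open>B\<close>; differences of a convergent sequence tend to 0.
\<close>

lemma quadratic_convergent_imp_const:
  fixes A B :: real
  assumes "(\<lambda>n. A * (real n)\<^sup>2 + B * real n) \<longlonglongrightarrow> L"
  shows "A = 0" "B = 0"
proof -
  let ?r = "\<lambda>n. A * (real n)\<^sup>2 + B * real n"
  have 1: "(\<lambda>n. ?r (Suc n)) \<longlonglongrightarrow> L" using assms by (rule LIMSEQ_Suc)
  then have 2: "(\<lambda>n. ?r (Suc (Suc n))) \<longlonglongrightarrow> L" by (rule LIMSEQ_Suc)
  have "(\<lambda>n. ?r (Suc (Suc n)) - 2 * ?r (Suc n) + ?r n) \<longlonglongrightarrow> L - 2 * L + L"
    by (intro tendsto_intros assms 1 2)
  then have "(\<lambda>n::nat. 2 * A) \<longlonglongrightarrow> 0" by (simp add: power2_eq_square algebra_simps)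
  then show A: "A = 0" by (simp add: LIMSEQ_const_iff)
  have "(\<lambda>n. ?r (Suc n) - ?r n) \<longlonglongrightarrow> L - L"
    by (intro tendsto_intros assms 1)
  then show "B = 0" by (simp add: A algebra_simps LIMSEQ_const_iff)
qed

lemma cdf_normal_ne_cdf_min_std_normal:
  fixes m \<sigma> :: real
  assumes \<sigma>: "\<sigma> > 0"
  defines "F \<equiv> cdf std_normal_distribution"
  shows "\<exists>x. cdf (density lborel (normal_density m \<sigma>)) x \<noteq> 1 - (1 - F x) * (1 - F x)"
proof (rule ccontr)
  assume "\<not> ?thesis"
  then have eq: "cdf (density lborel (normal_density m \<sigma>)) = (\<lambda>x. 1 - (1 - F x) * (1 - F x))"
    by auto
  interpret N: real_distribution std_normal_distribution by (rule real_dist_normal_dist)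
  \<comment> \<open>The coefficients of the logarithm of the quotient of the densities of the normal law with
    parameters \<open>m\<close> and \<open>\<sigma>\<close> and of the standard normal law.\<close>
  define A where "A = 1/2 - 1 / (2 * \<sigma>\<^sup>2)"
  define B where "B = m / \<sigma>\<^sup>2"
  define C where "C = - m\<^sup>2 / (2 * \<sigma>\<^sup>2) - ln \<sigma>"
  have tail: "2 * (1 - F x) = exp (A * x\<^sup>2 + B * x + C)" for x
  proof -
    have F': "(F has_real_derivative std_normal_density x) (at x)"
      unfolding F_def by (rule cdf_normal_has_derivative) simp
    have "((\<lambda>x. 1 - (1 - F x) * (1 - F x)) has_real_derivative
        2 * (1 - F x) * std_normal_density x) (at x)"
      by (auto intro!: derivative_eq_intros F')
    moreover have "((\<lambda>x. 1 - (1 - F x) * (1 - F x)) has_real_derivative normal_density m \<sigma> x) (at x)"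
      using cdf_normal_has_derivative[OF \<sigma>, of m x] unfolding eq .
    ultimately have "2 * (1 - F x) * std_normal_density x = normal_density m \<sigma> x"
      by (rule DERIV_unique)
    also have "normal_density m \<sigma> x = exp (A * x\<^sup>2 + B * x + C) * std_normal_density x"
    proof -
      have "A * x\<^sup>2 + B * x + C + (- x\<^sup>2 / 2) = - (x - m)\<^sup>2 / (2 * \<sigma>\<^sup>2) - ln \<sigma>"
        using \<sigma> unfolding A_def B_def C_def by (simp add: field_simps power2_eq_square)
      then have "exp (A * x\<^sup>2 + B * x + C) * exp (- x\<^sup>2 / 2) = exp (- (x - m)\<^sup>2 / (2 * \<sigma>\<^sup>2)) / \<sigma>"
        using \<sigma> by (simp flip: exp_add add: exp_diff)
      then show ?thesis
        using \<sigma> by (simp add: normal_density_def real_sqrt_mult)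
    qed
    finally show ?thesis
      using normal_density_pos[of 1 0 x] by simp
  qed
  have "(\<lambda>n. 2 * (1 - F (- real n))) \<longlonglongrightarrow> 2 * (1 - 0)"
    unfolding F_def by (intro tendsto_intros N.cdf_lim_neg_infty)
  then have "(\<lambda>n. exp (A * (real n)\<^sup>2 + (- B) * real n + C)) \<longlonglongrightarrow> 2"
    unfolding tail by simp
  then have "(\<lambda>n. ln (exp (A * (real n)\<^sup>2 + (- B) * real n + C)) - C) \<longlonglongrightarrow> ln 2 - C"
    by (intro tendsto_intros) auto
  then have "(\<lambda>n. A * (real n)\<^sup>2 + (- B) * real n) \<longlonglongrightarrow> ln 2 - C"
    by simp
  from quadratic_convergent_imp_const[OF this] have "A = 0" "B = 0" by simp_all
  then have const: "2 * (1 - F x) = exp C" for x using tail[of x] by simp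
  have "(\<lambda>n. 2 * (1 - F (real n))) \<longlonglongrightarrow> 2 * (1 - 1)"
    unfolding F_def by (intro tendsto_intros N.cdf_lim_infty_prob)
  then show False unfolding const by (simp add: LIMSEQ_const_iff)
qed

theorem mainTheorem3:
  fixes M :: "'w measure"
    and X Y :: "nat \<Rightarrow> 'w \<Rightarrow> letter"
    and p :: real
    and P :: "'v measure"
    and \<N>1 \<N>2 :: "'v \<Rightarrow> real"
  assumes "prob_space M"
    and X_indep: "prob_space.indep_vars M (\<lambda>_. count_space UNIV) X {1..}"
    and Y_indep: "prob_space.indep_vars M (\<lambda>_. count_space UNIV) Y {1..}"
    and X_ident: "\<And>i. i \<ge> 1 \<Longrightarrow>
      distr M (count_space UNIV) (X i) = distr M (count_space UNIV) (X 1)"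
    and Y_ident: "\<And>i. i \<ge> 1 \<Longrightarrow>
      distr M (count_space UNIV) (Y i) = distr M (count_space UNIV) (X 1)"
    and XY_indep: "prob_space.indep_var M
      (\<Pi>\<^sub>M i\<in>{1..}. count_space UNIV) (\<lambda>\<omega>. \<lambda>i\<in>{1..}. X i \<omega>)
      (\<Pi>\<^sub>M i\<in>{1..}. count_space UNIV) (\<lambda>\<omega>. \<lambda>i\<in>{1..}. Y i \<omega>)"
    and p_def: "p = measure M {\<omega>\<in>space M. X 1 \<omega> = letter_a}"
    and p_bounds: "0 < p" "p < 1"
    and "prob_space P"
    and N1: "distributed P lborel \<N>1 std_normal_density"
    and N2: "distributed P lborel \<N>2 std_normal_density"
    and N_indep: "prob_space.indep_var P borel \<N>1 borel \<N>2"
  shows "(\<forall>n. \<forall>\<omega>\<in>space M.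
        optimal_score score n (\<lambda>i. X i \<omega>) (\<lambda>i. Y i \<omega>) =
        min (real (count_a n (\<lambda>i. X i \<omega>))) (real (count_a n (\<lambda>i. Y i \<omega>)))) \<and>
      weak_conv_m
        (\<lambda>n. distr M borel (\<lambda>\<omega>.
          (optimal_score score n (\<lambda>i. X i \<omega>) (\<lambda>i. Y i \<omega>) -
            prob_space.expectation M (\<lambda>\<omega>'. real (count_a n (\<lambda>i. X i \<omega>')))) /
          sqrt (real n * p * (1 - p))))
        (distr P borel (\<lambda>\<omega>. min (\<N>1 \<omega>) (\<N>2 \<omega>))) \<and>
      \<not> (\<exists>m \<sigma>. \<sigma> > 0 \<and>
        distributed P lborel (\<lambda>\<omega>. min (\<N>1 \<omega>) (\<N>2 \<omega>)) (normal_density m \<sigma>))"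
proof -
  interpret M: prob_space M by fact
  interpret P: prob_space P by fact
  define D where "D = distr M (count_space UNIV) (X 1)"
  have X1: "X 1 \<in> measurable M (count_space UNIV)"
    using X_indep unfolding M.indep_vars_def2 by auto
  have p: "p = measure D {letter_a}"
    using X1 by (simp add: p_def D_def measure_distr) (auto intro!: arg_cong[where f="measure M"])
  note X = X_indep X_ident[folded D_def] p p_bounds
  note Y = Y_indep Y_ident[folded D_def] p p_bounds
  define T :: "nat \<Rightarrow> (nat \<Rightarrow> letter) \<Rightarrow> real"
    where "T n z = (real (count_a n z) - real n * p) / sqrt (real n * p * (1 - p))" for n z
  have score: "(optimal_score score n x y - M.expectation (\<lambda>\<omega>'. real (count_a n (\<lambda>i. X i \<omega>')))) /
      sqrt (real n * p * (1 - p)) = min (T n x) (T n y)" for n x y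
    using p_bounds
    by (simp add: optimal_score_score M.expectation_count_a[OF X] T_def min_diff_distrib_left min_divide_distrib_right)

  \<comment> \<open>The independence hypothesis concerns the restricted sequences, on which \<open>T n\<close> takes the same
    values because it reads only the positions from 1 to \<open>n\<close>.\<close>
  have T_restrict: "T n (restrict z {1..}) = T n z" for n z
    by (simp add: T_def count_a_eq_sum)
  have T_meas: "T n \<in> measurable (\<Pi>\<^sub>M i\<in>{1..}. count_space UNIV) borel" for n
    unfolding T_def count_a_eq_sum by measurable
  have T_indep: "M.indep_var borel (\<lambda>\<omega>. T n (\<lambda>i. X i \<omega>)) borel (\<lambda>\<omega>. T n (\<lambda>i. Y i \<omega>))" for n
    using M.indep_var_compose[OF XY_indep T_meas T_meas, of n n]
    unfolding o_def T_restrict .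

  have N_distr: "distr P borel N = std_normal_distribution"
    if "distributed P lborel N std_normal_density" for N
    using distributed_distr_eq_density[OF that] by (simp cong: distr_cong)
  note N1' = N_distr[OF N1] and N2' = N_distr[OF N2]

  have conv: "weak_conv_m (\<lambda>n. distr M borel (\<lambda>\<omega>. min (T n (\<lambda>i. X i \<omega>)) (T n (\<lambda>i. Y i \<omega>))))
      (distr P borel (\<lambda>\<omega>. min (\<N>1 \<omega>) (\<N>2 \<omega>)))"
    by (rule weak_conv_min_indep[OF M.prob_space_axioms P.prob_space_axioms T_indep N_indep])
      (simp_all add: N1' N2' isCont_cdf_std_normal T_def
        M.count_a_weak_conv[OF X] M.count_a_weak_conv[OF Y])
  have not_normal: "\<not> distributed P lborel (\<lambda>\<omega>. min (\<N>1 \<omega>) (\<N>2 \<omega>)) (normal_density m \<sigma>)"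
    if \<sigma>: "\<sigma> > 0" for m \<sigma>
  proof
    assume "distributed P lborel (\<lambda>\<omega>. min (\<N>1 \<omega>) (\<N>2 \<omega>)) (normal_density m \<sigma>)"
    from distributed_distr_eq_density[OF this]
    have "distr P borel (\<lambda>\<omega>. min (\<N>1 \<omega>) (\<N>2 \<omega>)) = density lborel (normal_density m \<sigma>)"
      by (simp cong: distr_cong)
    then show False
      using P.cdf_min_indep[OF N_indep] cdf_normal_ne_cdf_min_std_normal[OF \<sigma>, of m]
      by (simp add: N1' N2')
  qed
  show ?thesis
    unfolding score using conv not_normal by (auto simp: optimal_score_score)
qed

end
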